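(* Let $\eta,\eta'\in\Omega^*$. Then $\nu_{\eta}$ and $\nu_{\eta'}$ are strongly singular if and only if $\eta'\notin\overline{o}_-(\eta)$ and $\eta\notin\overline{o}_-(\eta')$.
   Context: $\mathbb{N}=\{1,2,3,\dots\}$, $\beta\mathbb{N}$ is its Stone–Čech compactification and $\mathbb{N}^*=\beta\mathbb{N}\setminus\mathbb{N}$, whose points are the free ultrafilters on $\mathbb{N}$. Let $\tau:\beta\mathbb{N}\to\beta\mathbb{N}$ be the continuous extension of $n\mapsto n+1$; its restriction to $\mathbb{N}^*$ is a homeomorphism of $\mathbb{N}^*$ onto itself. $\Omega^*$ is the quotient space of $\mathbb{N}^*\times[0,1]$ obtained by identifying $(\omega,1)$ with $(\tau\omega,0)$ for all $\omega\in\mathbb{N}^*$. For $s\in\mathbb{R}$, the homeomorphism $\phi^s:\Omega^*\to\Omega^*$ is $\phi^s(\omega,t)=(\tau^{[t+s]}\omega,\ t+s-[t+s])$, where $[x]$ is the largest integer not exceeding $x$. Put $o_-(\eta)=\{\phi^{-s}(\eta): s\ge 0\}$ and let $\overline{o}_-(\eta)$ be its closure in $\Omega^*$. For $\eta=(\omega,t)\in\Omega^*$, with $\theta=2^t$, $\nu_\eta$ is the finitely additive probability measure on $\mathcal{P}(\mathbb{N})$ given by $\nu_\eta(A)=\omega\text{-}\lim_n \frac{|A\cap\{1,\dots,[\theta\cdot 2^n]\}|}{\theta\cdot 2^n}$, the limit being taken along the ultrafilter $\omega$. Finitely additive probability measures $\mu,\nu$ on $\mathcal{P}(\mathbb{N})$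 are strongly singular if there is $D\in\mathcal{P}(\mathbb{N})$ with $\mu(D)=0$ and $\nu(D^c)=0$. *)

theory Defs
  imports "HOL-Analysis.Analysis"
begin

section \<open>Ultrafilters on the positive integers\<close>

abbreviation posnat :: "nat set" where
  "posnat \<equiv> {1..}"

definition ultrafilter :: "'a filter \<Rightarrow> bool" where
  "ultrafilter F \<longleftrightarrow> F \<noteq> bot \<and> (\<forall>P. eventually P F \<or> eventually (\<lambda>x. \<not> P x) F)"

text \<open>
  A point of the Stone--Cech compactification of the positive integers is an ultrafilter on them;
  it is represented by the ultrafilter on \<^typ>\<open>nat\<close> that it generates, that is, one that
  contains \<^term>\<open>posnat\<close>. A positive integer \<open>n\<close> corresponds to the ultrafilter
  \<^term>\<open>principal {n}\<close>.
\<close>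

definition beta_N :: "nat filter set" where
  "beta_N = {\<omega>. ultrafilter \<omega> \<and> eventually (\<lambda>n. n \<in> posnat) \<omega>}"

definition basic_open :: "nat set \<Rightarrow> nat filter set" where
  "basic_open A = {\<omega> \<in> beta_N. eventually (\<lambda>n. n \<in> A) \<omega>}"

definition beta_N_top :: "nat filter topology" where
  "beta_N_top = topology_generated_by (basic_open ` Pow posnat)"

definition N_star :: "nat filter set" where
  "N_star = beta_N - (\<lambda>n. principal {n}) ` posnat"

definition N_star_top :: "nat filter topology" where
  "N_star_top = subtopology beta_N_top N_star"

text \<open>
  The continuous extension of \<open>n \<mapsto> n + 1\<close> is the push-forward of ultrafilters under
  \<^const>\<open>Suc\<close>; see \<open>continuous_map_tau\<close>, \<open>tau_principal\<close> and \<open>tau_unique\<close>.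
\<close>

definition tau :: "nat filter \<Rightarrow> nat filter" where
  "tau \<omega> = filtermap Suc \<omega>"

text \<open>Integer iterates of the bijection \<^const>\<open>tau\<close> of \<^const>\<open>N_star\<close>.\<close>

definition tau_pow :: "int \<Rightarrow> nat filter \<Rightarrow> nat filter" where
  "tau_pow k = (if 0 \<le> k then tau ^^ nat k else inv_into N_star tau ^^ nat (- k))"

lemma ultrafilter_eq:
  assumes "ultrafilter F" "ultrafilter G" "\<And>P. eventually P F \<Longrightarrow> eventually P G"
  shows "F = G"
proof (rule filter_eq_iff[THEN iffD2], intro allI iffI)
  fix P assume "eventually P F" then show "eventually P G" using assms(3) by blast
next
  fix P assume P: "eventually P G"
  show "eventually P F"
  proof (rule ccontr)
    assume "\<not> eventually P F"
    then have "eventually (\<lambda>x. \<not> P x) G" using assms(1,3) unfolding ultrafilter_def by blast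
    with P have "eventually (\<lambda>x. False) G" by eventually_elim auto
    then show False using assms(2) by (simp add: ultrafilter_def eventually_False)
  qed
qed

lemma topspace_beta_N [simp]: "topspace beta_N_top = beta_N"
proof -
  have "basic_open posnat = beta_N" by (auto simp: basic_open_def beta_N_def)
  moreover have "basic_open A \<subseteq> beta_N" for A by (auto simp: basic_open_def)
  ultimately show ?thesis unfolding beta_N_top_def by auto
qed

lemma topspace_N_star [simp]: "topspace N_star_top = N_star"
  by (auto simp: N_star_top_def N_star_def)

lemma openin_basic_open: "A \<subseteq> posnat \<Longrightarrow> openin beta_N_top (basic_open A)"
  unfolding beta_N_top_def by (rule topology_generated_by_Basis) auto

lemma principal_in_beta_N: "n \<in> posnat \<Longrightarrow> principal {n} \<in> beta_N"
  by (auto simp: beta_N_def ultrafilter_def eventually_principal principal_eq_bot_iff)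

lemma tau_in_beta_N: "\<omega> \<in> beta_N \<Longrightarrow> tau \<omega> \<in> beta_N"
  by (auto simp: beta_N_def ultrafilter_def tau_def eventually_filtermap filtermap_bot_iff)

lemma tau_principal: "tau (principal {n}) = principal {n + 1}"
  by (simp add: tau_def)

lemma continuous_map_tau: "continuous_map beta_N_top beta_N_top tau"
proof -
  have "openin beta_N_top (tau -` basic_open A \<inter> topspace beta_N_top)" if "A \<subseteq> posnat" for A
  proof -
    have "tau -` basic_open A \<inter> topspace beta_N_top = basic_open {n \<in> posnat. Suc n \<in> A}"
      using tau_in_beta_N
      by (auto simp: basic_open_def tau_def eventually_filtermap beta_N_def eventually_conj_iff)
    moreover have "openin beta_N_top (basic_open {n \<in> posnat. Suc n \<in> A})"
      by (rule openin_basic_open) blast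
    ultimately show ?thesis by (simp only:)
  qed
  moreover have "tau ` beta_N \<subseteq> beta_N" using tau_in_beta_N by auto
  ultimately show ?thesis
    using topspace_beta_N
    unfolding beta_N_top_def continuous_on_generated_topo_iff by auto
qed

lemma openin_beta_N_top_basis:
  assumes "openin beta_N_top V" "\<omega> \<in> V"
  shows "\<exists>A\<subseteq>posnat. \<omega> \<in> basic_open A \<and> basic_open A \<subseteq> V"
proof -
  have "generate_topology_on (basic_open ` Pow posnat) V"
    using assms(1) by (simp add: beta_N_top_def openin_topology_generated_by_iff)
  then show ?thesis using assms(2)
  proof (induction arbitrary: \<omega>)
    case (Int a b)
    obtain A where "A \<subseteq> posnat" "\<omega> \<in> basic_open A" "basic_open A \<subseteq> a"
      using Int.IH(1)[of \<omega>] Int.prems by blast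
    moreover obtain B where "B \<subseteq> posnat" "\<omega> \<in> basic_open B" "basic_open B \<subseteq> b"
      using Int.IH(2)[of \<omega>] Int.prems by blast
    moreover have "basic_open (A \<inter> B) = basic_open A \<inter> basic_open B"
      by (auto simp: basic_open_def eventually_conj_iff)
    ultimately show ?case by (intro exI[of _ "A \<inter> B"]) blast
  next
    case (UN K)
    then obtain k where "k \<in> K" "\<omega> \<in> k" by blast
    then show ?case using UN.IH[of k \<omega>] by blast
  next
    case (Basis s)
    then show ?case by blast
  qed simp
qed

lemma tau_unique:
  assumes f: "continuous_map beta_N_top beta_N_top f"
    and ext: "\<And>n. n \<in> posnat \<Longrightarrow> f (principal {n}) = principal {n + 1}"
    and \<omega>: "\<omega> \<in> beta_N"
  shows "f \<omega> = tau \<omega>"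
proof (rule ultrafilter_eq)
  have f\<omega>: "f \<omega> \<in> beta_N" using f \<omega> by (auto simp: continuous_map_def)
  then show "ultrafilter (f \<omega>)" by (simp add: beta_N_def)
  show "ultrafilter (tau \<omega>)" using tau_in_beta_N[OF \<omega>] by (simp add: beta_N_def)
  fix P assume P: "eventually P (f \<omega>)"
  let ?A = "{n \<in> posnat. P n}"
  have "f \<omega> \<in> basic_open ?A"
    using f\<omega> P by (auto simp: basic_open_def beta_N_def eventually_conj_iff)
  then have "\<omega> \<in> {x \<in> topspace beta_N_top. f x \<in> basic_open ?A}" using \<omega> by simp
  moreover have "openin beta_N_top {x \<in> topspace beta_N_top. f x \<in> basic_open ?A}"
    by (rule openin_continuous_map_preimage[OF f openin_basic_open]) auto
  ultimately obtain B where B: "B \<subseteq> posnat" "\<omega> \<in> basic_open B"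
      "basic_open B \<subseteq> {x \<in> topspace beta_N_top. f x \<in> basic_open ?A}"
    by (meson openin_beta_N_top_basis)
  have "P (Suc n)" if "n \<in> B" for n
  proof -
    have "principal {n} \<in> basic_open B"
      using that B(1) principal_in_beta_N by (auto simp: basic_open_def eventually_principal)
    then have "f (principal {n}) \<in> basic_open ?A" using B(3) by blast
    moreover have "f (principal {n}) = principal {n + 1}" using ext that B(1) by blast
    ultimately show ?thesis by (auto simp: basic_open_def eventually_principal)
  qed
  moreover have "eventually (\<lambda>n. n \<in> B) \<omega>" using B(2) by (simp add: basic_open_def)
  ultimately show "eventually P (tau \<omega>)"
    unfolding tau_def eventually_filtermap by (auto elim: eventually_mono)
qed

lemma ultrafilter_principal_if:
  assumes "ultrafilter F" "eventually (\<lambda>x. x = a) F"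
  shows "F = principal {a}"
proof (rule ultrafilter_eq[symmetric])
  show "ultrafilter (principal {a})"
    by (auto simp: ultrafilter_def eventually_principal principal_eq_bot_iff)
  show "eventually P F" if "eventually P (principal {a})" for P
    using that assms(2) by (auto simp: eventually_principal elim: eventually_mono)
qed (use assms in auto)

lemma N_star_iff:
  "\<omega> \<in> N_star \<longleftrightarrow> ultrafilter \<omega> \<and> (\<forall>k. eventually (\<lambda>n. n \<noteq> k) \<omega>)"
proof
  assume \<omega>: "\<omega> \<in> N_star"
  then have u: "ultrafilter \<omega>" and p: "eventually (\<lambda>n. n \<in> posnat) \<omega>"
    by (auto simp: N_star_def beta_N_def)
  have "eventually (\<lambda>n. n \<noteq> k) \<omega>" for k
  proof (cases "k \<in> posnat")
    case True
    then have "\<not> eventually (\<lambda>n. n = k) \<omega>"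
      using \<omega> ultrafilter_principal_if[OF u] by (auto simp: N_star_def)
    then show ?thesis using u unfolding ultrafilter_def by blast
  next
    case False
    with p show ?thesis by (auto elim: eventually_mono)
  qed
  with u show "ultrafilter \<omega> \<and> (\<forall>k. eventually (\<lambda>n. n \<noteq> k) \<omega>)" by blast
next
  assume *: "ultrafilter \<omega> \<and> (\<forall>k. eventually (\<lambda>n. n \<noteq> k) \<omega>)"
  then have "eventually (\<lambda>n. n \<noteq> 0) \<omega>" by blast
  then have "eventually (\<lambda>n. n \<in> posnat) \<omega>" by (auto elim: eventually_mono)
  moreover have "\<omega> \<noteq> principal {n}" for n
    using * by (auto simp: eventually_principal)
  ultimately show "\<omega> \<in> N_star" using * by (auto simp: N_star_def beta_N_def)
qed

lemma tau_in_N_star: "\<omega> \<in> N_star \<Longrightarrow> tau \<omega> \<in> N_star"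
proof -
  assume \<omega>: "\<omega> \<in> N_star"
  have "eventually (\<lambda>n. Suc n \<noteq> k) \<omega>" for k
    using \<omega> by (cases k) (auto simp: N_star_iff)
  with \<omega> show ?thesis
    by (auto simp: N_star_iff ultrafilter_def tau_def eventually_filtermap filtermap_bot_iff)
qed

lemma bij_betw_tau: "bij_betw tau N_star N_star"
proof (rule bij_betw_imageI)
  show "inj_on tau N_star"
    by (rule inj_onI) (simp add: tau_def filtermap_eq_strong)
  have "\<omega> \<in> tau ` N_star" if \<omega>: "\<omega> \<in> N_star" for \<omega>
  proof -
    define \<omega>' where "\<omega>' = filtermap (\<lambda>n. n - 1) \<omega>"
    have "eventually (\<lambda>n. n - 1 \<noteq> k) \<omega>" for k
    proof -
      have "eventually (\<lambda>n. n \<noteq> 0 \<and> n \<noteq> Suc k) \<omega>"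
        using \<omega> unfolding N_star_iff eventually_conj_iff by blast
      then show ?thesis by (auto elim!: eventually_mono)
    qed
    with \<omega> have "\<omega>' \<in> N_star"
      by (auto simp: \<omega>'_def N_star_iff ultrafilter_def eventually_filtermap filtermap_bot_iff)
    moreover have "tau \<omega>' = \<omega>"
    proof -
      have "eventually (\<lambda>n. n \<noteq> 0) \<omega>" using \<omega> unfolding N_star_iff by blast
      then have "eventually (\<lambda>n. P (Suc (n - 1))) \<omega> \<longleftrightarrow> eventually P \<omega>" for P
        by (intro eventually_cong) (auto elim!: eventually_mono)
      then show ?thesis by (simp add: tau_def \<omega>'_def filter_eq_iff eventually_filtermap)
    qed
    ultimately show ?thesis by blast
  qed
  then show "tau ` N_star = N_star" using tau_in_N_star by blast
qed

lemma tau_pow_add1: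
  assumes "\<omega> \<in> N_star"
  shows "tau_pow (k + 1) \<omega> = tau_pow k (tau \<omega>)"
proof -
  have inv: "inv_into N_star tau (tau \<omega>) = \<omega>"
    by (rule inv_into_f_f[OF bij_betw_imp_inj_on[OF bij_betw_tau] assms])
  consider "k \<ge> 0" | "k = -1" | "k < -1" by linarith
  then show ?thesis
  proof cases
    case 1
    then have "nat (k + 1) = Suc (nat k)" by simp
    with 1 show ?thesis by (simp add: tau_pow_def funpow_swap1)
  next
    case 2
    then show ?thesis using inv by (simp add: tau_pow_def)
  next
    case 3
    then have "nat (- k) = Suc (nat (- (k + 1)))" by simp
    with 3 inv show ?thesis by (simp add: tau_pow_def funpow_Suc_right del: funpow.simps)
  qed
qed


section \<open>The suspension and its flow\<close>

definition glue :: "nat filter \<times> real \<Rightarrow> nat filter \<times> real \<Rightarrow> bool" where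
  "glue p q \<longleftrightarrow> (\<exists>\<omega>\<in>N_star. p = (\<omega>, 1) \<and> q = (tau \<omega>, 0))"

text \<open>
  Points of the quotient are classes of the equivalence relation generated by \<^const>\<open>glue\<close>.
\<close>

definition Omega_proj :: "nat filter \<times> real \<Rightarrow> (nat filter \<times> real) set" where
  "Omega_proj p = {q. equivclp glue p q}"

definition Omega :: "(nat filter \<times> real) set set" where
  "Omega = Omega_proj ` (N_star \<times> {0..1})"

text \<open>The quotient topology; see \<open>quotient_map_Omega_proj\<close>.\<close>

definition Omega_top :: "(nat filter \<times> real) set topology" where
  "Omega_top = topology (\<lambda>V. V \<subseteq> Omega \<and>
     openin (prod_topology N_star_top (top_of_set {0..1}))
       {p \<in> N_star \<times> {0..1}. Omega_proj p \<in> V})"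

text \<open>
  Maps on \<^const>\<open>Omega\<close> are given by formulas in a representative \<open>(\<omega>, t)\<close>. The set of values
  of such a formula on a class is a singleton, whose element is selected by \<^const>\<open>the_elem\<close>;
  see \<open>phi_Omega_proj\<close> and \<open>nu_Omega_proj\<close>.
\<close>

definition phi :: "real \<Rightarrow> (nat filter \<times> real) set \<Rightarrow> (nat filter \<times> real) set" where
  "phi s \<eta> = the_elem ((\<lambda>(\<omega>, t). Omega_proj (tau_pow \<lfloor>t + s\<rfloor> \<omega>, t + s - of_int \<lfloor>t + s\<rfloor>)) ` \<eta>)"

definition o_minus :: "(nat filter \<times> real) set \<Rightarrow> (nat filter \<times> real) set set" where
  "o_minus \<eta> = {phi (- s) \<eta> | s. 0 \<le> s}"

lemma Omega_proj_eq: "equivclp glue p q \<Longrightarrow> Omega_proj p = Omega_proj q"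
proof -
  assume pq: "equivclp glue p q"
  have "equivclp glue p r \<longleftrightarrow> equivclp glue q r" for r
    using equivclp_trans[OF pq, of r] equivclp_trans[OF equivclp_sym[OF pq], of r] by (rule iffI[rotated])
  then show ?thesis by (simp only: Omega_proj_def)
qed

lemma the_elem_Omega_proj:
  assumes "\<And>p q. glue p q \<Longrightarrow> f p = f q"
  shows "the_elem (f ` Omega_proj p) = f p"
proof -
  have "f p = f q" if "equivclp glue p q" for q
    using that
  proof (induction rule: equivclp_induct)
    case (step y z)
    from step.hyps(2) have "f y = f z"
      by (rule disjE) (erule assms, erule assms[symmetric])
    with step.IH show ?case by (rule trans)
  qed (rule refl)
  moreover have "p \<in> Omega_proj p" by (simp add: Omega_proj_def)
  moreover have "q \<in> Omega_proj p \<Longrightarrow> equivclp glue p q" for q by (simp add: Omega_proj_def)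
  ultimately have "f q = f p" if "q \<in> Omega_proj p" for q using that by metis
  with \<open>p \<in> Omega_proj p\<close> have "f ` Omega_proj p = {f p}" by blast
  then show ?thesis by simp
qed

lemma phi_Omega_proj:
  "phi s (Omega_proj (\<omega>, t)) = Omega_proj (tau_pow \<lfloor>t + s\<rfloor> \<omega>, t + s - of_int \<lfloor>t + s\<rfloor>)"
proof -
  have "\<lfloor>1 + s\<rfloor> = \<lfloor>s\<rfloor> + 1" by linarith
  with tau_pow_add1 show ?thesis
    unfolding phi_def by (subst the_elem_Omega_proj) (auto simp: glue_def add.commute[of 1])
qed

lemma openin_Omega_top:
  "openin Omega_top V \<longleftrightarrow> V \<subseteq> Omega \<and>
     openin (prod_topology N_star_top (top_of_set {0..1}))
       {p \<in> N_star \<times> {0..1}. Omega_proj p \<in> V}" (is "_ \<longleftrightarrow> ?P V")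
proof -
  let ?X = "prod_topology N_star_top (top_of_set {0..1::real})"
  have "istopology ?P"
    unfolding istopology_def
  proof (intro conjI allI impI)
    fix S T assume S: "?P S" and T: "?P T"
    have "{p \<in> N_star \<times> {0..1}. Omega_proj p \<in> S \<inter> T} =
        {p \<in> N_star \<times> {0..1}. Omega_proj p \<in> S} \<inter> {p \<in> N_star \<times> {0..1}. Omega_proj p \<in> T}"
      by auto
    then show "openin ?X {p \<in> N_star \<times> {0..1}. Omega_proj p \<in> S \<inter> T}"
      using S T by (metis (no_types, lifting) openin_Int)
    show "S \<inter> T \<subseteq> Omega" using S by auto
  next
    fix K assume K: "\<forall>S\<in>K. ?P S"
    have "{p \<in> N_star \<times> {0..1}. Omega_proj p \<in> \<Union>K} =
        (\<Union>S\<in>K. {p \<in> N_star \<times> {0..1}. Omega_proj p \<in> S})"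
      by auto
    moreover have "openin ?X \<dots>" using K by (intro openin_Union) auto
    ultimately show "openin ?X {p \<in> N_star \<times> {0..1}. Omega_proj p \<in> \<Union>K}" by simp
    show "\<Union>K \<subseteq> Omega" using K by auto
  qed
  then show ?thesis by (simp add: Omega_top_def topology_inverse')
qed

lemma topspace_Omega_top [simp]: "topspace Omega_top = Omega"
proof -
  have "{p \<in> N_star \<times> {0..1}. Omega_proj p \<in> Omega}
      = topspace (prod_topology N_star_top (top_of_set {0..1}))"
    by (auto simp: Omega_def)
  then have "openin Omega_top Omega"
    unfolding openin_Omega_top by (metis openin_topspace order_refl)
  then show ?thesis
    by (metis openin_Omega_top openin_subset openin_topspace subset_antisym)
qed

lemma quotient_map_Omega_proj:
  "quotient_map (prod_topology N_star_top (top_of_set {0..1})) Omega_top Omega_proj"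
  by (auto simp: quotient_map_def openin_Omega_top Omega_def)


section \<open>The measures\<close>

definition fin_add_prob :: "(nat set \<Rightarrow> real) \<Rightarrow> bool" where
  "fin_add_prob \<mu> \<longleftrightarrow> (\<forall>A\<subseteq>posnat. 0 \<le> \<mu> A) \<and> \<mu> posnat = 1 \<and>
     (\<forall>A\<subseteq>posnat. \<forall>B\<subseteq>posnat. A \<inter> B = {} \<longrightarrow> \<mu> (A \<union> B) = \<mu> A + \<mu> B)"

definition strongly_singular :: "(nat set \<Rightarrow> real) \<Rightarrow> (nat set \<Rightarrow> real) \<Rightarrow> bool" where
  "strongly_singular \<mu> \<nu> \<longleftrightarrow> (\<exists>D\<subseteq>posnat. \<mu> D = 0 \<and> \<nu> (posnat - D) = 0)"

definition avg :: "real \<Rightarrow> nat set \<Rightarrow> nat \<Rightarrow> real" where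
  "avg \<theta> A n = real (card (A \<inter> {1..nat \<lfloor>\<theta> * 2 ^ n\<rfloor>})) / (\<theta> * 2 ^ n)"

definition nu :: "(nat filter \<times> real) set \<Rightarrow> nat set \<Rightarrow> real" where
  "nu \<eta> A = the_elem ((\<lambda>(\<omega>, t). Lim \<omega> (avg (2 powr t) A)) ` \<eta>)"

lemma nu_Omega_proj: "nu (Omega_proj (\<omega>, t)) A = Lim \<omega> (avg (2 powr t) A)"
proof -
  have "avg 2 A = (\<lambda>n. avg 1 A (Suc n))" by (auto simp: avg_def fun_eq_iff)
  then have "Lim \<omega>' (avg 2 A) = Lim (tau \<omega>') (avg 1 A)" for \<omega>'
    by (simp add: Topological_Spaces.Lim_def tau_def filterlim_filtermap)
  then show ?thesis
    unfolding nu_def by (subst the_elem_Omega_proj) (auto simp: glue_def)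
qed

lemma ultrafilter_tendsto_compact:
  fixes f :: "'a \<Rightarrow> 'b::t2_space"
  assumes F: "ultrafilter F" and K: "compact K" and ev: "eventually (\<lambda>x. f x \<in> K) F"
  shows "(f \<longlongrightarrow> Lim F f) F"
proof -
  have nt: "F \<noteq> bot" using F by (simp add: ultrafilter_def)
  then have "filtermap f F \<noteq> bot" by (simp add: filtermap_bot_iff)
  moreover have "eventually (\<lambda>x. x \<in> K) (filtermap f F)" using ev by (simp add: eventually_filtermap)
  ultimately obtain l where l: "inf (nhds l) (filtermap f F) \<noteq> bot"
    using K unfolding compact_filter by blast
  have "(f \<longlongrightarrow> l) F"
  proof (rule topological_tendstoI)
    fix S assume S: "open S" "l \<in> S"
    show "eventually (\<lambda>x. f x \<in> S) F"
    proof (rule ccontr)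
      assume "\<not> eventually (\<lambda>x. f x \<in> S) F"
      then have "eventually (\<lambda>x. f x \<notin> S) F" using F unfolding ultrafilter_def by blast
      then have "eventually (\<lambda>x. x \<notin> S) (filtermap f F)" by (simp add: eventually_filtermap)
      moreover have "eventually (\<lambda>x. x \<in> S) (nhds l)" using S by (rule eventually_nhds_in_open)
      ultimately have "eventually (\<lambda>x. False) (inf (nhds l) (filtermap f F))"
        unfolding eventually_inf by blast
      with l show False by (simp add: eventually_False)
    qed
  qed
  with tendsto_Lim[OF nt] show ?thesis by metis
qed

lemma avg_bounds:
  assumes "\<theta> > 0" shows "0 \<le> avg \<theta> A n" "avg \<theta> A n \<le> 1"
proof -
  have "card (A \<inter> {1..nat \<lfloor>\<theta> * 2 ^ n\<rfloor>}) \<le> nat \<lfloor>\<theta> * 2 ^ n\<rfloor>"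
    using card_mono[of "{1..nat \<lfloor>\<theta> * 2 ^ n\<rfloor>}" "A \<inter> {1..nat \<lfloor>\<theta> * 2 ^ n\<rfloor>}"] by simp
  moreover have "real (nat \<lfloor>\<theta> * 2 ^ n\<rfloor>) \<le> \<theta> * 2 ^ n" using assms by simp
  ultimately have "real (card (A \<inter> {1..nat \<lfloor>\<theta> * 2 ^ n\<rfloor>})) \<le> \<theta> * 2 ^ n" by linarith
  then show "avg \<theta> A n \<le> 1" using assms by (simp add: avg_def divide_le_eq)
  show "0 \<le> avg \<theta> A n" using assms by (simp add: avg_def)
qed

lemma N_star_le_sequentially:
  assumes "\<omega> \<in> N_star" shows "\<omega> \<le> sequentially"
proof -
  have "eventually (\<lambda>n. N \<le> n) \<omega>" for N
  proof -
    have "eventually (\<lambda>n. \<forall>k\<in>{..<N}. n \<noteq> k) \<omega>"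
      by (rule eventually_ball_finite) (use assms in \<open>auto simp: N_star_iff\<close>)
    then show ?thesis by (auto elim!: eventually_mono simp: not_less[symmetric])
  qed
  then show ?thesis
    unfolding le_filter_def eventually_sequentially by (blast intro: eventually_mono)
qed

lemma tendsto_avg:
  assumes "\<omega> \<in> N_star"
  shows "(avg (2 powr t) A \<longlongrightarrow> nu (Omega_proj (\<omega>, t)) A) \<omega>"
  unfolding nu_Omega_proj
  using assms avg_bounds[of "2 powr t" A]
  by (intro ultrafilter_tendsto_compact[where K = "{0..1}"]) (auto simp: N_star_iff)

lemma fin_add_prob_nu:
  assumes "\<eta> \<in> Omega" shows "fin_add_prob (nu \<eta>)"
proof -
  obtain \<omega> t where \<omega>: "\<omega> \<in> N_star" and \<eta>: "\<eta> = Omega_proj (\<omega>, t)"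
    using assms by (auto simp: Omega_def)
  have nt: "\<omega> \<noteq> bot" using \<omega> by (simp add: N_star_iff ultrafilter_def)
  note lim = tendsto_avg[OF \<omega>, of t, folded \<eta>]
  define \<theta> :: real where "\<theta> = 2 powr t"
  have \<theta>: "\<theta> > 0" by (simp add: \<theta>_def)
  have "0 \<le> nu \<eta> A" for A
    by (rule tendsto_lowerbound[OF lim _ nt]) (simp add: avg_bounds)
  moreover have "nu \<eta> (A \<union> B) = nu \<eta> A + nu \<eta> B" if "A \<inter> B = {}" for A B
  proof -
    have "avg \<theta> (A \<union> B) n = avg \<theta> A n + avg \<theta> B n" for n
    proof -
      have "card ((A \<union> B) \<inter> {1..m}) = card (A \<inter> {1..m}) + card (B \<inter> {1..m})" for m
        by (subst card_Un_disjoint[symmetric])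
           (use that in \<open>auto simp: Int_Un_distrib2\<close>)
      then show ?thesis by (simp add: avg_def add_divide_distrib)
    qed
    then have "avg \<theta> (A \<union> B) = (\<lambda>n. avg \<theta> A n + avg \<theta> B n)" by (rule ext)
    then have "(avg \<theta> (A \<union> B) \<longlongrightarrow> nu \<eta> A + nu \<eta> B) \<omega>"
      using tendsto_add[OF lim lim, of A B, folded \<theta>_def] by (simp only:)
    then show ?thesis using tendsto_unique[OF nt lim] by (metis \<theta>_def)
  qed
  moreover have "nu \<eta> posnat = 1"
  proof -
    have "(avg \<theta> posnat \<longlongrightarrow> 1) sequentially"
    proof (rule tendsto_sandwich)
      have "1 - (1 / \<theta>) * (1 / 2) ^ n \<le> avg \<theta> posnat n" for n
      proof -
        have "posnat \<inter> {1..m} = {1..m}" for m by auto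
        moreover have "real (nat \<lfloor>\<theta> * 2 ^ n\<rfloor>) \<ge> \<theta> * 2 ^ n - 1" by linarith
        ultimately have "(\<theta> * 2 ^ n - 1) / (\<theta> * 2 ^ n) \<le> avg \<theta> posnat n"
          using \<theta> by (simp add: avg_def divide_right_mono)
        moreover have "(\<theta> * 2 ^ n - 1) / (\<theta> * 2 ^ n) = 1 - (1 / \<theta>) * (1 / 2) ^ n"
          using \<theta> by (simp add: field_simps)
        ultimately show ?thesis by simp
      qed
      then show "eventually (\<lambda>n. 1 - (1 / \<theta>) * (1 / 2) ^ n \<le> avg \<theta> posnat n) sequentially" by simp
      show "eventually (\<lambda>n. avg \<theta> posnat n \<le> 1) sequentially" by (simp add: avg_bounds \<theta>)
      have "((\<lambda>n. (1 / 2 :: real) ^ n) \<longlongrightarrow> 0) sequentially" by (rule LIMSEQ_realpow_zero) auto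
      from tendsto_diff[OF tendsto_const tendsto_mult_left[OF this], of 1 "1 / \<theta>"]
      show "((\<lambda>n. 1 - (1 / \<theta>) * (1 / 2) ^ n) \<longlongrightarrow> 1) sequentially" by simp
    qed auto
    then have "(avg \<theta> posnat \<longlongrightarrow> 1) \<omega>"
      using N_star_le_sequentially[OF \<omega>] by (rule tendsto_mono[rotated])
    then show ?thesis using tendsto_unique[OF nt lim] by (metis \<theta>_def)
  qed
  ultimately show ?thesis by (simp add: fin_add_prob_def)
qed

end

theory Submission
  imports Defs
begin

text \<open>
  Read \<open>\<eta> = (\<omega>, t)\<close> as the limit along \<open>\<omega>\<close> of the logarithmic scales \<open>n + t\<close>. Moving a scale
  backwards by \<open>s\<close> enlarges averages at most by the factor \<open>2\<^sup>s\<close>, so a null set of \<open>\<nu>\<^sub>\<eta>\<close> is null along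
  the whole backward orbit of \<open>\<eta>\<close>, and by continuity on its closure. Conversely, if neither point
  lies in the orbit closure of the other, there are \<open>A \<in> \<omega>\<close> and \<open>A' \<in> \<omega>'\<close> such that the gap from
  \<open>n + t\<close> back to the preceding point of \<open>A' + t'\<close> tends to infinity along \<open>\<omega>\<close>, and symmetrically.
  The set \<open>D\<close> of all \<open>k\<close> whose logarithm lies between a point of \<open>A' + t'\<close> and the preceding point
  of \<open>A + t\<close> then separates the two measures.
\<close>

section \<open>Backward orbits in coordinates\<close>

text \<open>Truncated predecessor is an exact left inverse of \<open>Suc\<close>, so its
  push-forward inverts \<open>tau\<close>. Membership in \<open>N_star\<close> goes through the same
  induction because it supplies the preimage under \<open>tau\<close>.\<close>

lemma tau_pow_minus:
  assumes "\<omega> \<in> N_star"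
  shows "tau_pow (- int j) \<omega> \<in> N_star \<and> tau_pow (- int j) \<omega> = filtermap (\<lambda>n. n - j) \<omega>"
proof (induction j)
  case 0
  with assms show ?case by (simp add: tau_pow_def filtermap_ident)
next
  case (Suc j)
  let ?\<alpha> = "tau_pow (- int j) \<omega>"
  \<comment> \<open>Exponent 0 falls under the nonnegative branch of \<open>tau_pow\<close>, hence
    the split on \<open>j\<close>.\<close>
  have step: "tau_pow (- int (Suc j)) \<omega> = inv_into N_star tau ?\<alpha>"
    by (cases j) (simp_all add: tau_pow_def nat_add_distrib)
  obtain \<beta> where \<beta>: "\<beta> \<in> N_star" "?\<alpha> = tau \<beta>"
    using Suc.IH bij_betw_tau by (metis bij_betw_imp_surj_on imageE)
  then have "inv_into N_star tau ?\<alpha> = \<beta>"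
    by (simp add: inv_into_f_f[OF bij_betw_imp_inj_on[OF bij_betw_tau]])
  moreover have "filtermap (\<lambda>n. n - Suc j) \<omega> = filtermap (\<lambda>n. n - 1) ?\<alpha>"
    using Suc.IH by (simp add: filtermap_filtermap)
  moreover have "filtermap (\<lambda>n. n - 1) (tau \<beta>) = \<beta>"
    by (simp add: tau_def filtermap_filtermap filtermap_ident)
  ultimately show ?case using \<beta> step by simp
qed

text \<open>Gluing moves level 1 to level 0. With \<open>t < 1\<close>, flowing back by
  \<open>s \<ge> 0\<close> gives \<open>\<lfloor>t - s\<rfloor> \<le> 0\<close>, so no positive
  power of \<open>tau\<close> occurs.\<close>

lemma Omega_cases:
  assumes "\<eta> \<in> Omega"
  obtains \<omega> t where "\<omega> \<in> N_star" "0 \<le> t" "t < 1" "\<eta> = Omega_proj (\<omega>, t)"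
proof -
  obtain \<omega> t where \<omega>: "\<omega> \<in> N_star" "0 \<le> t" "t \<le> 1" "\<eta> = Omega_proj (\<omega>, t)"
    using assms by (auto simp: Omega_def)
  show ?thesis
  proof (cases "t = 1")
    case True
    have "Omega_proj (\<omega>, 1) = Omega_proj (tau \<omega>, 0)"
      by (rule Omega_proj_eq) (use \<omega> in \<open>auto simp: glue_def\<close>)
    with True \<omega> that[of "tau \<omega>" 0] tau_in_N_star show ?thesis by simp
  next
    case False
    with \<omega> that show ?thesis by auto
  qed
qed

text \<open>The relation between \<open>u\<close>, \<open>j\<close> and \<open>s\<close> says that
  the scale \<open>n + t\<close> moves to \<open>(n - j) + u = n + t - s\<close>.\<close>

lemma phi_minus:
  assumes "\<omega> \<in> N_star" "0 \<le> t" "t < 1" "0 \<le> s"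
  obtains j u where "phi (- s) (Omega_proj (\<omega>, t)) = Omega_proj (filtermap (\<lambda>n. n - j) \<omega>, u)"
    "filtermap (\<lambda>n. n - j) \<omega> \<in> N_star" "u - real j = t - s"
proof -
  define j where "j = nat (- \<lfloor>t - s\<rfloor>)"
  have j: "\<lfloor>t - s\<rfloor> = - int j" using assms unfolding j_def by linarith
  show ?thesis
  proof
    show "phi (- s) (Omega_proj (\<omega>, t)) = Omega_proj (filtermap (\<lambda>n. n - j) \<omega>, t - s + real j)"
      using tau_pow_minus[OF assms(1), of j] by (simp add: phi_Omega_proj j)
    show "filtermap (\<lambda>n. n - j) \<omega> \<in> N_star" using tau_pow_minus[OF assms(1), of j] by metis
  qed simp
qed

section \<open>Null sets along backward orbits\<close>

lemma nu_phi_minus_eq_0: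
  assumes \<eta>: "\<eta> \<in> Omega" and s: "0 \<le> s" and D: "nu \<eta> D = 0"
  shows "nu (phi (- s) \<eta>) D = 0"
proof -
  obtain \<omega> t where \<omega>: "\<omega> \<in> N_star" "0 \<le> t" "t < 1" "\<eta> = Omega_proj (\<omega>, t)"
    using Omega_cases[OF \<eta>] .
  obtain j u where j: "phi (- s) \<eta> = Omega_proj (filtermap (\<lambda>n. n - j) \<omega>, u)"
    "filtermap (\<lambda>n. n - j) \<omega> \<in> N_star" and u: "u - real j = t - s"
    using phi_minus[OF \<omega>(1-3) s] unfolding \<omega>(4) by metis
  have nt: "\<omega> \<noteq> bot" using \<omega> by (simp add: N_star_iff ultrafilter_def)
  have lim: "((\<lambda>n. avg (2 powr u) D (n - j)) \<longlongrightarrow> nu (phi (- s) \<eta>) D) \<omega>"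
    using tendsto_avg[OF j(2), of u D] by (simp add: j(1) filterlim_filtermap)
  have lim0: "((\<lambda>n. 2 powr s * avg (2 powr t) D n) \<longlongrightarrow> 0) \<omega>"
    using tendsto_mult_left[OF tendsto_avg[OF \<omega>(1), of t D], of "2 powr s"] D
    unfolding \<omega>(4) by (simp only: mult_zero_right)
  \<comment> \<open>The window at \<open>n - j\<close> is the one at \<open>n\<close> shortened by
    the factor \<open>2 powr s\<close>, and the count can only drop. The condition
    \<open>n \<ge> j\<close> rules out truncation and holds eventually along
    \<open>\<omega>\<close>.\<close>
  have le: "avg (2 powr u) D (n - j) \<le> 2 powr s * avg (2 powr t) D n" if "n \<ge> j" for n
  proof -
    have "2 powr u * 2 ^ (n - j) = (2::real) powr (t - s + real n)"
    proof -
      have "u + real (n - j) = t - s + real n" using that u by (simp add: of_nat_diff)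
      then show ?thesis by (metis powr_add powr_realpow zero_less_numeral)
    qed
    also have "\<dots> = 2 powr t * 2 ^ n / 2 powr s"
      by (simp add: powr_realpow[symmetric] powr_add[symmetric] powr_diff[symmetric] algebra_simps)
    finally have eq: "2 powr u * 2 ^ (n - j) = (2::real) powr t * 2 ^ n / 2 powr s" .
    have "(2::real) powr t * 2 ^ n / 2 powr s \<le> 2 powr t * 2 ^ n"
      using s ge_one_powr_ge_zero[of 2 s] by (simp add: divide_le_eq)
    then have "card (D \<inter> {1..nat \<lfloor>(2::real) powr t * 2 ^ n / 2 powr s\<rfloor>})
        \<le> card (D \<inter> {1..nat \<lfloor>(2::real) powr t * 2 ^ n\<rfloor>})"
      by (intro card_mono Int_mono) (auto simp: nat_mono floor_mono)
    then show ?thesis unfolding avg_def eq by (simp add: field_simps)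
  qed
  have "nu (phi (- s) \<eta>) D \<le> 0"
    by (rule tendsto_le[OF nt lim0 lim],
        rule filter_leD[OF N_star_le_sequentially[OF \<omega>(1)]])
       (use le in \<open>auto simp: eventually_sequentially\<close>)
  moreover have "0 \<le> nu (phi (- s) \<eta>) D"
    by (rule tendsto_lowerbound[OF lim _ nt]) (simp add: avg_bounds)
  ultimately show ?thesis by simp
qed

section \<open>Null sets on closures of backward orbits\<close>

text \<open>Only integers between the two floors can be gained; the 1 covers rounding.\<close>

lemma card_le_card_add_diff:
  fixes x y :: real
  assumes "0 \<le> x" "0 \<le> y"
  shows "real (card (D \<inter> {1..nat \<lfloor>y\<rfloor>})) \<le> real (card (D \<inter> {1..nat \<lfloor>x\<rfloor>})) + \<bar>y - x\<bar> + 1"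
proof -
  have "D \<inter> {1..nat \<lfloor>y\<rfloor>} \<subseteq> (D \<inter> {1..nat \<lfloor>x\<rfloor>}) \<union> {nat \<lfloor>x\<rfloor><..nat \<lfloor>y\<rfloor>}" by auto
  then have "card (D \<inter> {1..nat \<lfloor>y\<rfloor>}) \<le> card ((D \<inter> {1..nat \<lfloor>x\<rfloor>}) \<union> {nat \<lfloor>x\<rfloor><..nat \<lfloor>y\<rfloor>})"
    by (intro card_mono) auto
  also have "\<dots> \<le> card (D \<inter> {1..nat \<lfloor>x\<rfloor>}) + (nat \<lfloor>y\<rfloor> - nat \<lfloor>x\<rfloor>)"
    using card_Un_le[of "D \<inter> {1..nat \<lfloor>x\<rfloor>}" "{nat \<lfloor>x\<rfloor><..nat \<lfloor>y\<rfloor>}"] by simp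
  finally have "real (card (D \<inter> {1..nat \<lfloor>y\<rfloor>})) \<le>
    real (card (D \<inter> {1..nat \<lfloor>x\<rfloor>})) + real (nat \<lfloor>y\<rfloor> - nat \<lfloor>x\<rfloor>)" by linarith
  moreover have "real (nat \<lfloor>y\<rfloor> - nat \<lfloor>x\<rfloor>) \<le> \<bar>y - x\<bar> + 1" using assms by linarith
  ultimately show ?thesis by linarith
qed

text \<open>This makes nullity of \<open>D\<close> a closed condition on \<open>Omega\<close>.
  Replacing \<open>t\<close> by a nearby \<open>u\<close> changes the count by a small multiple of
  \<open>2 ^ n\<close> plus 1, so one set \<open>A\<close> of indices serves all such
  \<open>u\<close>.\<close>

lemma openin_nu_pos: "openin Omega_top {\<eta> \<in> Omega. 0 < nu \<eta> D}"
  unfolding openin_Omega_top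
proof (intro conjI)
  have "\<exists>U W. openin N_star_top U \<and> openin (top_of_set {0..1}) W \<and> \<omega> \<in> U \<and> t \<in> W \<and>
      U \<times> W \<subseteq> {p \<in> N_star \<times> {0..1}. Omega_proj p \<in> {\<eta> \<in> Omega. 0 < nu \<eta> D}}"
    if \<omega>: "\<omega> \<in> N_star" and t: "t \<in> {0..1}" and pos: "0 < nu (Omega_proj (\<omega>, t)) D" for \<omega> t
  proof -
    define c where "c = nu (Omega_proj (\<omega>, t)) D"
    \<comment> \<open>In units of \<open>2 ^ n\<close>, the count at \<open>t\<close> exceeds
      \<open>c / 2\<close>. Moving to \<open>u\<close> costs at most \<open>c / 8\<close>, and so
      does rounding for large \<open>n\<close>. At least \<open>c / 4\<close> remains, and division
      by \<open>2 powr u \<le> 2\<close> leaves \<open>c / 8\<close>.\<close>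
    define A where "A = {n \<in> posnat. c / 2 < avg (2 powr t) D n}"
    define W where "W = {0..1} \<inter> (\<lambda>u::real. 2 powr u) -` {2 powr t - c / 8<..<2 powr t + c / 8}"
    have c: "0 < c" using pos by (simp add: c_def)
    have "eventually (\<lambda>n. c / 2 < avg (2 powr t) D n) \<omega>"
      by (rule order_tendstoD(1)[OF tendsto_avg[OF \<omega>]]) (use c in \<open>simp add: c_def\<close>)
    then have "\<omega> \<in> basic_open A"
      using \<omega> by (auto simp: A_def basic_open_def N_star_def beta_N_def eventually_conj_iff)
    moreover have "openin N_star_top (N_star \<inter> basic_open A)"
      unfolding N_star_top_def by (rule openin_subtopology_Int2, rule openin_basic_open) (auto simp: A_def)
    moreover have "openin (top_of_set {0..1}) W"
      unfolding W_def by (rule continuous_openin_preimage_gen) (auto intro!: continuous_intros)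
    moreover have "t \<in> W" using t c by (simp add: W_def)
    moreover have "0 < nu (Omega_proj (\<alpha>, u)) D" if \<alpha>: "\<alpha> \<in> N_star" "\<alpha> \<in> basic_open A" and u: "u \<in> W" for \<alpha> u
    proof -
      have nt: "\<alpha> \<noteq> bot" using \<alpha> by (simp add: N_star_iff ultrafilter_def)
      have "eventually (\<lambda>n. (1 / 2 :: real) ^ n < c / 8) sequentially"
        by (rule order_tendstoD(2)[OF LIMSEQ_realpow_zero]) (use c in auto)
      then have "eventually (\<lambda>n. (1 / 2 :: real) ^ n < c / 8) \<alpha>"
        by (rule filter_leD[OF N_star_le_sequentially[OF \<alpha>(1)]])
      moreover have "eventually (\<lambda>n. n \<in> A) \<alpha>" using \<alpha>(2) by (simp add: basic_open_def)
      ultimately have "eventually (\<lambda>n. c / 8 \<le> avg (2 powr u) D n) \<alpha>"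
      proof eventually_elim
        case (elim n)
        let ?N = "\<lambda>t::real. real (card (D \<inter> {1..nat \<lfloor>2 powr t * 2 ^ n\<rfloor>}))"
        have t1: "(1::real) \<le> 2 powr t" using t by (simp add: ge_one_powr_ge_zero)
        have u2: "2 powr u \<le> (2::real)"
          using u powr_mono[of u 1 2] by (simp add: W_def)
        have "c / 2 * (2 powr t * 2 ^ n) < ?N t"
          using elim(2) by (simp add: A_def avg_def less_divide_eq)
        moreover have "c / 2 * (1 * 2 ^ n) \<le> c / 2 * (2 powr t * 2 ^ n)"
          using c t1 by (intro mult_left_mono mult_right_mono) auto
        moreover have "?N t \<le> ?N u + \<bar>2 powr t * 2 ^ n - 2 powr u * 2 ^ n\<bar> + 1"
          by (rule card_le_card_add_diff) auto
        moreover have "\<bar>2 powr t * 2 ^ n - 2 powr u * 2 ^ n\<bar> \<le> c / 8 * 2 ^ n"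
        proof -
          have "\<bar>2 powr t * 2 ^ n - 2 powr u * 2 ^ n\<bar> = \<bar>2 powr t - 2 powr u\<bar> * (2::real) ^ n"
            by (simp add: abs_mult left_diff_distrib[symmetric])
          also have "\<dots> \<le> c / 8 * 2 ^ n"
          proof (rule mult_right_mono)
            show "\<bar>2 powr t - 2 powr u\<bar> \<le> c / 8"
              using u unfolding W_def abs_le_iff by auto
          qed simp
          finally show ?thesis .
        qed
        moreover have "1 \<le> c / 8 * 2 ^ n"
          using elim(1) by (simp add: power_one_over field_simps)
        ultimately have "c / 4 * 2 ^ n \<le> ?N u" by linarith
        moreover have "c / 8 * (2 powr u * 2 ^ n) \<le> c / 8 * (2 * 2 ^ n)"
          using c u2 by (intro mult_left_mono mult_right_mono) auto
        ultimately have "c / 8 * (2 powr u * 2 ^ n) \<le> ?N u" by linarith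
        then show ?case by (simp add: avg_def le_divide_eq)
      qed
      then have "c / 8 \<le> nu (Omega_proj (\<alpha>, u)) D"
        by (rule tendsto_lowerbound[OF tendsto_avg[OF \<alpha>(1)] _ nt])
      with c show ?thesis by simp
    qed
    moreover have "W \<subseteq> {0..1}" by (auto simp: W_def)
    ultimately show ?thesis
      using \<omega> by (intro exI[of _ "N_star \<inter> basic_open A"] exI[of _ W]) (auto simp: Omega_def)
  qed
  then show "openin (prod_topology N_star_top (top_of_set {0..1}))
      {p \<in> N_star \<times> {0..1}. Omega_proj p \<in> {\<eta> \<in> Omega. 0 < nu \<eta> D}}"
    unfolding openin_prod_topology_alt by auto
qed auto

text \<open>An open set that meets the closure meets the orbit, where \<open>D\<close> stays
  null.\<close>

lemma nu_not_pos_on_closure_o_minus: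
  assumes "\<eta> \<in> Omega" "nu \<eta> D = 0" "\<xi> \<in> Omega_top closure_of o_minus \<eta>"
  shows "\<not> 0 < nu \<xi> D"
proof
  assume "0 < nu \<xi> D"
  moreover have "\<xi> \<in> Omega" using assms(3) by (simp add: in_closure_of)
  ultimately have "\<xi> \<in> {\<zeta> \<in> Omega. 0 < nu \<zeta> D}" by simp
  then obtain \<zeta> where \<zeta>: "\<zeta> \<in> o_minus \<eta>" "\<zeta> \<in> {\<zeta> \<in> Omega. 0 < nu \<zeta> D}"
    using assms(3) openin_nu_pos[of D] unfolding in_closure_of by meson
  obtain s where "0 \<le> s" "\<zeta> = phi (- s) \<eta>" using \<zeta>(1) unfolding o_minus_def by blast
  then have "nu \<zeta> D = 0" using nu_phi_minus_eq_0[OF assms(1) _ assms(2)] by simp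
  with \<zeta>(2) show False by simp
qed

text \<open>Additivity forces \<open>nu \<xi> D = 1\<close>, which cannot happen on the
  closure.\<close>

lemma not_in_closure_if_nu_eq_0:
  assumes "\<eta> \<in> Omega" "\<xi> \<in> Omega" "D \<subseteq> posnat" "nu \<eta> D = 0" "nu \<xi> (posnat - D) = 0"
  shows "\<xi> \<notin> Omega_top closure_of o_minus \<eta>"
proof -
  have "nu \<xi> (D \<union> (posnat - D)) = nu \<xi> D + nu \<xi> (posnat - D)"
    using fin_add_prob_nu[OF assms(2)] assms(3) unfolding fin_add_prob_def
    by (metis Diff_disjoint Diff_subset)
  moreover have "D \<union> (posnat - D) = posnat" using assms(3) by blast
  ultimately have "nu \<xi> D = 1"
    using fin_add_prob_nu[OF assms(2)] assms(5) by (simp add: fin_add_prob_def)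
  then show ?thesis using nu_not_pos_on_closure_o_minus[OF assms(1,4)] by force
qed

section \<open>Gaps between scales and the separating set\<close>

text \<open>\<open>A\<close> comes from a product neighbourhood of \<open>(\<omega>', t')\<close>
  that misses the backward orbit. That orbit is at level \<open>t'\<close> at the times
  \<open>j + t - t' \<ge> 0\<close>, with \<open>\<omega>\<close> shifted back by \<open>j\<close>;
  none of these shifts contains \<open>A\<close>.\<close>

lemma obtain_gap_set:
  assumes \<omega>: "\<omega> \<in> N_star" "0 \<le> t" "t < 1" and \<omega>': "\<omega>' \<in> N_star" "0 \<le> t'" "t' < 1"
    and notin: "Omega_proj (\<omega>', t') \<notin> Omega_top closure_of o_minus (Omega_proj (\<omega>, t))"
  obtains A where "eventually (\<lambda>n. n \<in> A) \<omega>'"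
    "\<And>j. t' \<le> real j + t \<Longrightarrow> eventually (\<lambda>n. n - j \<notin> A) \<omega>"
proof -
  have "Omega_proj (\<omega>', t') \<in> Omega" using \<omega>' by (auto simp: Omega_def)
  with notin obtain T where T: "openin Omega_top T" "Omega_proj (\<omega>', t') \<in> T"
      and disj: "\<And>\<zeta>. \<zeta> \<in> o_minus (Omega_proj (\<omega>, t)) \<Longrightarrow> \<zeta> \<notin> T"
    unfolding in_closure_of by auto
  let ?P = "{p \<in> N_star \<times> {0..1}. Omega_proj p \<in> T}"
  have "(\<omega>', t') \<in> ?P" using T(2) \<omega>' by auto
  moreover have "openin (prod_topology N_star_top (top_of_set {0..1})) ?P"
    using T(1) by (simp add: openin_Omega_top)
  ultimately obtain U W where U: "openin N_star_top U" "\<omega>' \<in> U" "t' \<in> W" "U \<times> W \<subseteq> ?P"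
    unfolding openin_prod_topology_alt by blast
  obtain V where V: "openin beta_N_top V" "U = V \<inter> N_star"
    using U(1) by (auto simp: N_star_top_def openin_subtopology)
  obtain A where A: "A \<subseteq> posnat" "\<omega>' \<in> basic_open A" "basic_open A \<subseteq> V"
    using openin_beta_N_top_basis[OF V(1)] U(2) V(2) by blast
  show ?thesis
  proof
    show "eventually (\<lambda>n. n \<in> A) \<omega>'" using A(2) by (simp add: basic_open_def)
    fix j assume j: "t' \<le> real j + t"
    let ?\<alpha> = "filtermap (\<lambda>n. n - j) \<omega>"
    have \<alpha>: "?\<alpha> \<in> N_star" "tau_pow (- int j) \<omega> = ?\<alpha>"
      using tau_pow_minus[OF \<omega>(1), of j] by auto
    \<comment> \<open>Flowing back for time \<open>j + t - t'\<close> leads from \<open>t\<close> to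
      \<open>t' - j\<close>, whose fractional part is \<open>t'\<close>.\<close>
    have fl: "\<lfloor>t' - real j\<rfloor> = - int j" using \<omega>' by linarith
    have "phi (- (real j + t - t')) (Omega_proj (\<omega>, t)) = Omega_proj (?\<alpha>, t')"
      using fl \<alpha>(2) by (simp add: phi_Omega_proj)
    moreover have "0 \<le> real j + t - t'" using j by simp
    ultimately have "Omega_proj (?\<alpha>, t') \<in> o_minus (Omega_proj (\<omega>, t))"
      unfolding o_minus_def by blast
    then have "Omega_proj (?\<alpha>, t') \<notin> T" by (rule disj)
    then have "?\<alpha> \<notin> basic_open A" using U(3,4) V(2) A(3) \<alpha>(1) by blast
    then have "\<not> eventually (\<lambda>n. n - j \<in> A) \<omega>"
      using \<alpha>(1) by (auto simp: basic_open_def N_star_def eventually_filtermap)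
    then show "eventually (\<lambda>n. n - j \<notin> A) \<omega>"
      using \<omega>(1) unfolding N_star_iff ultrafilter_def by blast
  qed
qed

text \<open>The gap hypothesis pushes the scale \<open>m + t'\<close> in \<open>E\<close> below
  \<open>n + t - K\<close> for any fixed \<open>K\<close>. The part of \<open>E\<close> in the
  window then ends at \<open>2 powr (n + t - K)\<close>, so the average is at most
  \<open>(1 / 2) ^ K\<close>.\<close>

lemma nu_eq_0_if_gap:
  assumes \<omega>: "\<omega> \<in> N_star"
    and A: "\<And>j. t' \<le> real j + t \<Longrightarrow> eventually (\<lambda>n. n - j \<notin> A) \<omega>"
    and t: "t < 1" "0 \<le> t'"
    and E: "eventually (\<lambda>n. \<forall>k\<in>E. 0 < k \<longrightarrow> real k \<le> 2 powr (real n + t) \<longrightarrow>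
      (\<exists>m\<in>A. real m + t' \<le> real n + t \<and> real k \<le> 2 powr (real m + t'))) \<omega>"
  shows "nu (Omega_proj (\<omega>, t)) E = 0"
proof -
  have nt: "\<omega> \<noteq> bot" using \<omega> by (simp add: N_star_iff ultrafilter_def)
  note lim = tendsto_avg[OF \<omega>, of t E]
  have bound: "nu (Omega_proj (\<omega>, t)) E \<le> (1 / 2) ^ K" for K
  proof (rule tendsto_upperbound[OF lim _ nt])
    \<comment> \<open>These finitely many \<open>j\<close> cover every \<open>m = n - j\<close> with
      \<open>n + t - K < m + t' \<le> n + t\<close>.\<close>
    have "eventually (\<lambda>n. \<forall>j\<in>{j\<in>{..nat \<lceil>real K + t' - t\<rceil>}. t' \<le> real j + t}. n - j \<notin> A) \<omega>"
      by (rule eventually_ball_finite) (use A in auto)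
    with E show "eventually (\<lambda>n. avg (2 powr t) E n \<le> (1 / 2) ^ K) \<omega>"
    proof eventually_elim
      case (elim n)
      have eq: "2 powr t * 2 ^ n = (2::real) powr (real n + t)"
        by (simp add: powr_realpow[symmetric] powr_add)
      have "E \<inter> {1..nat \<lfloor>(2::real) powr (real n + t)\<rfloor>}
          \<subseteq> {1..nat \<lfloor>(2::real) powr (real n + t - real K)\<rfloor>}"
      proof
        fix k assume k: "k \<in> E \<inter> {1..nat \<lfloor>(2::real) powr (real n + t)\<rfloor>}"
        then have "0 < k" "real k \<le> 2 powr (real n + t)" by (auto, linarith)
        then obtain m where m: "m \<in> A" "real m + t' \<le> real n + t" "real k \<le> 2 powr (real m + t')"
          using elim(1) k by blast
        \<comment> \<open>Integrality enters here: \<open>m \<le> n + t - t' < n + 1\<close>. Hence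
          \<open>n - m\<close> is a true difference and can serve as \<open>j\<close>.\<close>
        have "m \<le> n" using m(2) t by linarith
        have "real m + t' \<le> real n + t - real K"
        proof (rule ccontr)
          assume "\<not> ?thesis"
          then have "real (n - m) < real K + t' - t" "t' \<le> real (n - m) + t"
            using \<open>m \<le> n\<close> m(2) by (auto simp: of_nat_diff)
          moreover from this have "n - m \<le> nat \<lceil>real K + t' - t\<rceil>" by linarith
          ultimately have "n - (n - m) \<notin> A" using elim(2) by blast
          with m(1) \<open>m \<le> n\<close> show False by simp
        qed
        then have "(2::real) powr (real m + t') \<le> 2 powr (real n + t - real K)"
          by (rule powr_mono) simp
        with m(3) have "real k \<le> 2 powr (real n + t - real K)" by (rule order_trans)
        then have "k \<le> nat \<lfloor>(2::real) powr (real n + t - real K)\<rfloor>" by (rule le_nat_floor)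
        with \<open>0 < k\<close> show "k \<in> {1..nat \<lfloor>(2::real) powr (real n + t - real K)\<rfloor>}"
          by simp
      qed
      then have "card (E \<inter> {1..nat \<lfloor>(2::real) powr (real n + t)\<rfloor>})
          \<le> card {1..nat \<lfloor>(2::real) powr (real n + t - real K)\<rfloor>}"
        by (intro card_mono) auto
      then have "real (card (E \<inter> {1..nat \<lfloor>(2::real) powr (real n + t)\<rfloor>}))
          \<le> real (nat \<lfloor>(2::real) powr (real n + t - real K)\<rfloor>)"
        by (simp only: of_nat_le_iff card_atLeastAtMost diff_Suc_1 One_nat_def)
      also have "\<dots> \<le> 2 powr (real n + t - real K)" by simp
      also have "\<dots> = (1 / 2) ^ K * 2 powr (real n + t)"
        by (simp add: powr_diff powr_realpow power_one_over)
      finally show ?case by (simp add: avg_def eq divide_le_eq)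
    qed
  qed
  have "nu (Omega_proj (\<omega>, t)) E \<le> 0"
    by (rule LIMSEQ_le_const[OF LIMSEQ_realpow_zero[of "1/2"]]) (use bound in auto)
  moreover have "0 \<le> nu (Omega_proj (\<omega>, t)) E"
    by (rule tendsto_lowerbound[OF lim _ nt]) (simp add: avg_bounds)
  ultimately show ?thesis by simp
qed

theorem theorem3p8:
  fixes \<eta> \<eta>' :: "(nat filter \<times> real) set"
  assumes "\<eta> \<in> Omega" and "\<eta>' \<in> Omega"
  shows "strongly_singular (nu \<eta>) (nu \<eta>') \<longleftrightarrow>
    \<eta>' \<notin> Omega_top closure_of o_minus \<eta> \<and> \<eta> \<notin> Omega_top closure_of o_minus \<eta>'"
proof
  assume "strongly_singular (nu \<eta>) (nu \<eta>')"
  then obtain D where D: "D \<subseteq> posnat" "nu \<eta> D = 0" "nu \<eta>' (posnat - D) = 0"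
    unfolding strongly_singular_def by blast
  \<comment> \<open>The second claim exchanges the two points and uses the complement of
    \<open>D\<close>.\<close>
  moreover have "posnat - (posnat - D) = D" using D(1) by blast
  ultimately show "\<eta>' \<notin> Omega_top closure_of o_minus \<eta> \<and> \<eta> \<notin> Omega_top closure_of o_minus \<eta>'"
    using not_in_closure_if_nu_eq_0[OF assms D] not_in_closure_if_nu_eq_0[OF assms(2,1), of "posnat - D"]
    by simp
next
  assume notin: "\<eta>' \<notin> Omega_top closure_of o_minus \<eta> \<and> \<eta> \<notin> Omega_top closure_of o_minus \<eta>'"
  obtain \<omega> t where \<omega>: "\<omega> \<in> N_star" "0 \<le> t" "t < 1" and \<eta>: "\<eta> = Omega_proj (\<omega>, t)"
    using Omega_cases[OF assms(1)] .
  obtain \<omega>' t' where \<omega>': "\<omega>' \<in> N_star" "0 \<le> t'" "t' < 1" and \<eta>': "\<eta>' = Omega_proj (\<omega>', t')"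
    using Omega_cases[OF assms(2)] .
  obtain A' where A': "eventually (\<lambda>n. n \<in> A') \<omega>'"
    "\<And>j. t' \<le> real j + t \<Longrightarrow> eventually (\<lambda>n. n - j \<notin> A') \<omega>"
    using obtain_gap_set[OF \<omega> \<omega>'] notin unfolding \<eta> \<eta>' by blast
  obtain A where A: "eventually (\<lambda>n. n \<in> A) \<omega>"
    "\<And>j. t \<le> real j + t' \<Longrightarrow> eventually (\<lambda>n. n - j \<notin> A) \<omega>'"
    using obtain_gap_set[OF \<omega>' \<omega>] notin unfolding \<eta> \<eta>' by blast
  \<comment> \<open>Quantifying over all earlier points of \<open>A + t\<close> replaces naming the
    preceding one and covers the case that there is none.\<close>
  define D where "D = {k \<in> posnat. \<exists>m\<in>A'. real k \<le> 2 powr (real m + t') \<and>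
    (\<forall>n\<in>A. real n + t \<le> real m + t' \<longrightarrow> 2 powr (real n + t) < real k)}"
  have "nu \<eta> D = 0"
    unfolding \<eta>
  proof (rule nu_eq_0_if_gap[OF \<omega>(1) A'(2) \<omega>(3) \<omega>'(2)])
    show "eventually (\<lambda>n. \<forall>k\<in>D. 0 < k \<longrightarrow> real k \<le> 2 powr (real n + t) \<longrightarrow>
      (\<exists>m\<in>A'. real m + t' \<le> real n + t \<and> real k \<le> 2 powr (real m + t'))) \<omega>"
      using A(1)
    proof eventually_elim
      case (elim n)
      show ?case
      proof (intro ballI impI)
        fix k assume "k \<in> D" and k: "real k \<le> 2 powr (real n + t)"
        then obtain m where "m \<in> A'" "real k \<le> 2 powr (real m + t')"
          "real n + t \<le> real m + t' \<longrightarrow> 2 powr (real n + t) < real k"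
          using elim unfolding D_def by blast
        \<comment> \<open>If \<open>n + t \<le> m + t'\<close>, then \<open>k\<close> would exceed
          \<open>2 powr (n + t)\<close>; so \<open>m\<close> lies on the required side.\<close>
        with k show "\<exists>m\<in>A'. real m + t' \<le> real n + t \<and> real k \<le> 2 powr (real m + t')"
          by (intro bexI[of _ m]) auto
      qed
    qed
  qed
  moreover have "nu \<eta>' (posnat - D) = 0"
    unfolding \<eta>'
  proof (rule nu_eq_0_if_gap[OF \<omega>'(1) A(2) \<omega>'(3) \<omega>(2)])
    show "eventually (\<lambda>n. \<forall>k\<in>posnat - D. 0 < k \<longrightarrow> real k \<le> 2 powr (real n + t') \<longrightarrow>
      (\<exists>m\<in>A. real m + t \<le> real n + t' \<and> real k \<le> 2 powr (real m + t))) \<omega>'"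
      using A'(1)
    proof eventually_elim
      case (elim n)
      show ?case
      proof (intro ballI impI)
        fix k assume "k \<in> posnat - D" "real k \<le> 2 powr (real n + t')"
        \<comment> \<open>Since \<open>n \<in> A'\<close>, it is a candidate witness for
          \<open>k \<in> D\<close>; its failure yields the point \<open>m\<close> of
          \<open>A\<close>.\<close>
        then obtain m where "m \<in> A" "real m + t \<le> real n + t'" "\<not> 2 powr (real m + t) < real k"
          using elim unfolding D_def by blast
        then show "\<exists>m\<in>A. real m + t \<le> real n + t' \<and> real k \<le> 2 powr (real m + t)"
          by (intro bexI[of _ m]) auto
      qed
    qed
  qed
  moreover have "D \<subseteq> posnat" by (auto simp: D_def)
  ultimately show "strongly_singular (nu \<eta>) (nu \<eta>')"
    unfolding strongly_singular_def by blast
qed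

end
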